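(* Let $F:\mathbb{R}^n\to 2^{\mathbb{R}^m}$ be a set-valued mapping with convex closed graph. (1) If $n=1$ and $\operatorname{graph}F$ is convex and compact, then $F$ is continuous (in the Hausdorff metric, on $\operatorname{dom}F$). (2) If $\operatorname{graph}F$ is a $P$-set (in $\mathbb{R}^n\times\mathbb{R}^m=\mathbb{R}^{n+m}$), then $F$ is continuous (in the Hausdorff metric, on $\operatorname{dom}F$).
   Context: For $F:\mathbb{R}^n\to2^{\mathbb{R}^m}$, $\operatorname{dom}F=\{x\in\mathbb{R}^n:F(x)\ne\emptyset\}$ and $\operatorname{graph}F=\{(x,y)\in\mathbb{R}^n\times\mathbb{R}^m : x\in\operatorname{dom}F,\ y\in F(x)\}$. $P$-sets: for a unit vector $q\in\mathbb{R}^N$ let $L(q)=\{z\in\mathbb{R}^N:\langle q,z\rangle=0\}$; each $z\in\mathbb{R}^N$ is written $z=x+\mu q=(x,\mu)$ with $x\in L(q)$, $\mu\in\mathbb{R}$, and $P_q z=x$ is the orthogonal projection onto $L(q)$. For a convex compact $A\subset\mathbb{R}^N$ define $f_{A,q}:P_qA\to\mathbb{R}$ by $f_{A,q}(x)=\min\{\mu : (x,\mu)\in A\}$. A convex compact set $A\subset\mathbb{R}^N$ is called a $P$-set if for every unit vector $q$ the function $f_{A,q}$ is continuous on $P_qA$. The Hausdorff distance is $h(A,B)=\inf\{h>0 : A\subset B+B_h(0),\ B\subset A+B_h(0)\}$, where $B_h(0)$ is the closed ball of radius $h$ centered at $0$. *)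

theory Defs
  imports "HOL-Analysis.Analysis"
begin

definition sv_dom :: "('a \<Rightarrow> 'b set) \<Rightarrow> 'a set" where
  "sv_dom F = {x. F x \<noteq> {}}"

definition sv_graph :: "('a \<Rightarrow> 'b set) \<Rightarrow> ('a \<times> 'b) set" where
  "sv_graph F = {(x, y). x \<in> sv_dom F \<and> y \<in> F x}"

text \<open>Orthogonal projection onto the hyperplane \<open>{z. q \<bullet> z = 0}\<close>; intended for unit vectors \<open>q\<close> only.\<close>

definition proj_along :: "'a::euclidean_space \<Rightarrow> 'a \<Rightarrow> 'a" where
  "proj_along q z = z - (q \<bullet> z) *\<^sub>R q"

text \<open>The minimum exists whenever \<open>A\<close> is compact and \<open>x \<in> proj_along q ` A\<close>.\<close>

definition lower_fun :: "'a::euclidean_space set \<Rightarrow> 'a \<Rightarrow> 'a \<Rightarrow> real" where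
  "lower_fun A q x = (LEAST \<mu>. x + \<mu> *\<^sub>R q \<in> A)"

definition P_set :: "'a::euclidean_space set \<Rightarrow> bool" where
  "P_set A \<longleftrightarrow> convex A \<and> compact A \<and>
     (\<forall>q. norm q = 1 \<longrightarrow> continuous_on (proj_along q ` A) (lower_fun A q))"

text \<open>Extended-real valued, so that the infimum of the empty set is \<open>\<infinity>\<close>; \<open>B + cball 0 r\<close> is the
  Minkowski sum.\<close>

definition hausdorff_distance :: "'a::real_normed_vector set \<Rightarrow> 'a set \<Rightarrow> ereal" where
  "hausdorff_distance A B =
     Inf {ereal r | r. r > 0 \<and> A \<subseteq> B + cball 0 r \<and> B \<subseteq> A + cball 0 r}"

definition hausdorff_continuous_on ::
  "'a::metric_space set \<Rightarrow> ('a \<Rightarrow> 'b::real_normed_vector set) \<Rightarrow> bool" where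
  "hausdorff_continuous_on S F \<longleftrightarrow>
     (\<forall>x0\<in>S. \<forall>\<epsilon>>0. \<exists>\<delta>>0. \<forall>x\<in>S.
        dist x x0 < \<delta> \<longrightarrow> hausdorff_distance (F x) (F x0) < ereal \<epsilon>)"

end

theory Submission
  imports Defs
begin

text \<open>Let \<open>G\<close> be the graph of \<open>F\<close>; both parts assume that it is compact. Compactness turns continuity
  in the Hausdorff metric into pointwise lower semicontinuity: every point \<open>y\<^sub>0\<close> of a value
  \<open>F x\<^sub>0\<close> has to be approximable by points of \<open>F x\<close> when \<open>x\<close> in the domain tends to \<open>x\<^sub>0\<close>
  (lemma \<open>hausdorff_continuous_on_if_compact_graph\<close>). The other half of the Hausdorff estimate,
  upper semicontinuity, and the uniformity in \<open>y\<^sub>0\<close> come from extracting convergent subsequences.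

  If the domain lies on a line (\<open>lower_semicontinuous_dim1\<close>), then on each side of \<open>x\<^sub>0\<close> either
  the domain is empty or it contains some \<open>b\<close> with a value \<open>y\<^sub>b\<close>; the segment from
  \<open>(x\<^sub>0, y\<^sub>0)\<close> to \<open>(b, y\<^sub>b)\<close> stays in \<open>G\<close> and passes over every \<open>x\<close> between \<open>x\<^sub>0\<close> and
  \<open>b\<close>, at a height that tends to \<open>y\<^sub>0\<close>.

  If \<open>G\<close> is a \<open>P\<close>-set (\<open>lower_semicontinuous_P_set\<close>), pick any \<open>y\<^sub>k \<in> F x\<^sub>k\<close> with
  \<open>x\<^sub>k \<longlongrightarrow> x\<^sub>0\<close>. After passing to a subsequence \<open>y\<^sub>k\<close> tends to some \<open>y\<^sub>1 \<in> F x\<^sub>0\<close>. If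
  \<open>y\<^sub>1 \<noteq> y\<^sub>0\<close>, the \<open>P\<close>-set condition is applied to the direction \<open>q\<close> from \<open>(x\<^sub>0, y\<^sub>0)\<close> to
  \<open>(x\<^sub>0, y\<^sub>1)\<close>: the two points have the same projection along \<open>q\<close>, so by continuity of the lower
  boundary the chords of \<open>G\<close> through \<open>(x\<^sub>k, y\<^sub>k)\<close> parallel to \<open>q\<close> reach down almost to
  \<open>(x\<^sub>0, y\<^sub>0)\<close>. Since \<open>q\<close> is vertical, these chords lie over \<open>x\<^sub>k\<close>.\<close>

section \<open>Hausdorff continuity and lower semicontinuity\<close>

lemma mem_sv_graph [simp]: "(x, y) \<in> sv_graph F \<longleftrightarrow> y \<in> F x"
  by (auto simp: sv_graph_def sv_dom_def)

definition lower_semicontinuous_on ::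
  "'a::metric_space set \<Rightarrow> ('a \<Rightarrow> 'b::metric_space set) \<Rightarrow> bool" where
  "lower_semicontinuous_on S F \<longleftrightarrow>
     (\<forall>x0\<in>S. \<forall>y0\<in>F x0. \<forall>\<epsilon>>0. \<exists>\<delta>>0. \<forall>x\<in>S. dist x x0 < \<delta> \<longrightarrow> (\<exists>y\<in>F x. dist y y0 < \<epsilon>))"

lemma sequence_if_no_delta:
  fixes x0 :: "'a::metric_space"
  assumes "\<not> (\<exists>\<delta>>0. \<forall>x\<in>S. dist x x0 < \<delta> \<longrightarrow> P x)"
  obtains X where "\<And>k::nat. X k \<in> S" "X \<longlonglongrightarrow> x0" "\<And>k. \<not> P (X k)"
proof -
  have "\<exists>x\<in>S. dist x x0 < inverse (real (Suc k)) \<and> \<not> P x" for k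
  proof -
    have "inverse (real (Suc k)) > 0" by simp
    then show ?thesis using assms by blast
  qed
  then obtain X where X: "\<And>k. X k \<in> S" "\<And>k. dist (X k) x0 < inverse (real (Suc k))"
      "\<And>k. \<not> P (X k)"
    by metis
  have "(\<lambda>k. dist (X k) x0) \<longlonglongrightarrow> 0"
    by (rule tendsto_sandwich[OF _ _ tendsto_const LIMSEQ_inverse_real_of_nat])
       (use X(2) in \<open>auto intro!: always_eventually less_imp_le\<close>)
  then have "X \<longlonglongrightarrow> x0" using tendsto_dist_iff by blast
  then show ?thesis by (rule that[OF X(1) _ X(3)])
qed

lemma compact_graph_convergent_subseq:
  fixes F :: "'a::metric_space \<Rightarrow> 'b::metric_space set"
  assumes "compact (sv_graph F)" "\<And>k::nat. Y k \<in> F (X k)" "X \<longlonglongrightarrow> x0"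
  obtains y and r :: "nat \<Rightarrow> nat"
    where "y \<in> F x0" "strict_mono r" "(\<lambda>k. Y (r k)) \<longlonglongrightarrow> y"
proof -
  have "seq_compact (sv_graph F)"
    using assms(1) by (simp add: compact_eq_seq_compact_metric)
  moreover have "\<forall>k. (X k, Y k) \<in> sv_graph F" using assms(2) by simp
  ultimately obtain l r where l: "l \<in> sv_graph F" "strict_mono r"
      "((\<lambda>k. (X k, Y k)) \<circ> r) \<longlonglongrightarrow> l"
    by (rule seq_compactE)
  have "(\<lambda>k. X (r k)) \<longlonglongrightarrow> fst l" "(\<lambda>k. Y (r k)) \<longlonglongrightarrow> snd l"
    using tendsto_fst[OF l(3)] tendsto_snd[OF l(3)] by (simp_all add: o_def)
  moreover have "(\<lambda>k. X (r k)) \<longlonglongrightarrow> x0"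
    using LIMSEQ_subseq_LIMSEQ[OF assms(3) l(2)] by (simp add: o_def)
  ultimately have "fst l = x0" using LIMSEQ_unique by blast
  with l(1) have "snd l \<in> F x0" by (metis mem_sv_graph prod.collapse)
  then show ?thesis using l(2) \<open>(\<lambda>k. Y (r k)) \<longlonglongrightarrow> snd l\<close> by (rule that)
qed

lemma mem_plus_cball: "y \<in> B + cball 0 r \<longleftrightarrow> (\<exists>b\<in>B. dist y b \<le> r)"
  for y :: "'a::real_normed_vector"
proof
  assume "y \<in> B + cball 0 r"
  then show "\<exists>b\<in>B. dist y b \<le> r"
    by (force elim!: set_plus_elim simp: dist_norm)
next
  assume "\<exists>b\<in>B. dist y b \<le> r"
  then obtain b where "b \<in> B" "dist y b \<le> r" by blast
  then have "b + (y - b) \<in> B + cball 0 r"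
    by (intro set_plus_intro) (auto simp: dist_norm norm_minus_commute)
  then show "y \<in> B + cball 0 r" by simp
qed

text \<open>If either inclusion of the Hausdorff estimate failed along some \<open>x\<^sub>k \<longlongrightarrow> x\<^sub>0\<close>, the violating
  points would accumulate at a point of \<open>F x\<^sub>0\<close>. For the first inclusion this is absurd at once;
  for the second it contradicts lower semicontinuity at the accumulation point.\<close>

lemma hausdorff_continuous_on_if_compact_graph:
  fixes F :: "'a::metric_space \<Rightarrow> 'b::real_normed_vector set"
  assumes cpt: "compact (sv_graph F)" and lsc: "lower_semicontinuous_on (sv_dom F) F"
  shows "hausdorff_continuous_on (sv_dom F) F"
  unfolding hausdorff_continuous_on_def
proof (intro ballI allI impI)
  fix x0 and \<epsilon> :: real
  assume x0: "x0 \<in> sv_dom F" and "\<epsilon> > 0"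
  define \<rho> where "\<rho> = \<epsilon> / 2"
  have \<rho>: "\<rho> > 0" "\<rho> < \<epsilon>" using \<open>\<epsilon> > 0\<close> by (auto simp: \<rho>_def)
  have upper: "\<exists>\<delta>>0. \<forall>x\<in>sv_dom F. dist x x0 < \<delta> \<longrightarrow> F x \<subseteq> F x0 + cball 0 \<rho>"
  proof (rule ccontr)
    assume no: "\<not> ?thesis"
    obtain X where X: "\<And>k. X k \<in> sv_dom F" "X \<longlonglongrightarrow> x0"
        "\<And>k. \<not> F (X k) \<subseteq> F x0 + cball 0 \<rho>"
      by (rule sequence_if_no_delta[OF no]) (rule that)
    then obtain Y where Y: "\<And>k. Y k \<in> F (X k)" "\<And>k. Y k \<notin> F x0 + cball 0 \<rho>"
      unfolding subset_iff by metis
    from compact_graph_convergent_subseq[OF cpt Y(1) X(2)]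
    obtain y r where y: "y \<in> F x0" "strict_mono r" "(\<lambda>k. Y (r k)) \<longlonglongrightarrow> y" .
    from tendstoD[OF y(3) \<rho>(1)] obtain k where "dist (Y (r k)) y < \<rho>"
      by (auto simp: eventually_sequentially)
    then show False using Y(2)[of "r k"] y(1) by (auto simp: mem_plus_cball)
  qed
  have lower: "\<exists>\<delta>>0. \<forall>x\<in>sv_dom F. dist x x0 < \<delta> \<longrightarrow> F x0 \<subseteq> F x + cball 0 \<rho>"
  proof (rule ccontr)
    assume no: "\<not> ?thesis"
    obtain X where X: "\<And>k. X k \<in> sv_dom F" "X \<longlonglongrightarrow> x0"
        "\<And>k. \<not> F x0 \<subseteq> F (X k) + cball 0 \<rho>"
      by (rule sequence_if_no_delta[OF no]) (rule that)
    then obtain Y where Y: "\<And>k. Y k \<in> F x0" "\<And>k. Y k \<notin> F (X k) + cball 0 \<rho>"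
      unfolding subset_iff by metis
    from compact_graph_convergent_subseq[of F Y "\<lambda>_. x0", OF cpt Y(1) tendsto_const]
    obtain y r where y: "y \<in> F x0" "strict_mono r" "(\<lambda>k. Y (r k)) \<longlonglongrightarrow> y" .
    have half: "\<rho> / 2 > 0" using \<rho> by simp
    then obtain \<delta> where \<delta>: "\<delta> > 0"
        "\<And>x. x \<in> sv_dom F \<Longrightarrow> dist x x0 < \<delta> \<Longrightarrow> \<exists>z\<in>F x. dist z y < \<rho> / 2"
      using lsc x0 y(1) unfolding lower_semicontinuous_on_def by meson
    have "(\<lambda>k. X (r k)) \<longlonglongrightarrow> x0"
      using LIMSEQ_subseq_LIMSEQ[OF X(2) y(2)] by (simp add: o_def)
    from eventually_conj[OF tendstoD[OF this \<delta>(1)] tendstoD[OF y(3) half]]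
    obtain k where k: "dist (X (r k)) x0 < \<delta>" "dist (Y (r k)) y < \<rho> / 2"
      by (auto simp: eventually_sequentially)
    from \<delta>(2)[OF X(1) k(1)] obtain z where z: "z \<in> F (X (r k))" "dist z y < \<rho> / 2"
      by blast
    have "dist (Y (r k)) z \<le> \<rho>"
      using dist_triangle2[of "Y (r k)" z y] k(2) z(2) by simp
    then show False using Y(2)[of "r k"] z(1) by (auto simp: mem_plus_cball)
  qed
  from upper obtain \<delta>1 where \<delta>1: "\<delta>1 > 0"
      "\<And>x. x \<in> sv_dom F \<Longrightarrow> dist x x0 < \<delta>1 \<Longrightarrow> F x \<subseteq> F x0 + cball 0 \<rho>" by blast
  from lower obtain \<delta>2 where \<delta>2: "\<delta>2 > 0"
      "\<And>x. x \<in> sv_dom F \<Longrightarrow> dist x x0 < \<delta>2 \<Longrightarrow> F x0 \<subseteq> F x + cball 0 \<rho>" by blast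
  show "\<exists>\<delta>>0. \<forall>x\<in>sv_dom F. dist x x0 < \<delta> \<longrightarrow> hausdorff_distance (F x) (F x0) < ereal \<epsilon>"
  proof (intro exI[of _ "min \<delta>1 \<delta>2"] conjI ballI impI)
    show "min \<delta>1 \<delta>2 > 0" using \<delta>1 \<delta>2 by simp
    fix x assume x: "x \<in> sv_dom F" "dist x x0 < min \<delta>1 \<delta>2"
    have "hausdorff_distance (F x) (F x0) \<le> ereal \<rho>"
      unfolding hausdorff_distance_def
      by (rule Inf_lower) (use \<delta>1(2)[of x] \<delta>2(2)[of x] x \<rho>(1) in auto)
    also have "\<dots> < ereal \<epsilon>" using \<rho>(2) by simp
    finally show "hausdorff_distance (F x) (F x0) < ereal \<epsilon>" .
  qed
qed

section \<open>Convex graphs over a one-dimensional space\<close>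

text \<open>Lower semicontinuity along a segment: the graph contains the segment from \<open>(x\<^sub>0, y\<^sub>0)\<close> to
  \<open>(b, y\<^sub>b)\<close>, which is the graph of a function that is continuous at \<open>x\<^sub>0\<close>.\<close>

lemma convex_graph_near_on_segment:
  fixes F :: "'a::real_normed_vector \<Rightarrow> 'b::real_normed_vector set"
  assumes conv: "convex (sv_graph F)" and y0: "y0 \<in> F x0" and yb: "yb \<in> F b"
    and "b \<noteq> x0" "\<epsilon> > 0"
  shows "\<exists>\<delta>>0. \<forall>x\<in>closed_segment x0 b. dist x x0 < \<delta> \<longrightarrow> (\<exists>y\<in>F x. dist y y0 < \<epsilon>)"
proof -
  \<comment> \<open>The parameter \<open>t\<close> satisfies \<open>dist x x0 = t * norm (b - x0)\<close> and
      \<open>dist y y0 = t * norm (yb - y0)\<close>; the added 1 avoids division by 0.\<close>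
  define \<delta> where "\<delta> = \<epsilon> * norm (b - x0) / (norm (yb - y0) + 1)"
  have pos: "norm (yb - y0) + 1 > 0" by (simp add: add_nonneg_pos)
  have "\<delta> > 0" using assms pos by (simp add: \<delta>_def)
  moreover have "\<exists>y\<in>F x. dist y y0 < \<epsilon>"
    if x: "x \<in> closed_segment x0 b" "dist x x0 < \<delta>" for x
  proof -
    from x(1) obtain t where t: "0 \<le> t" "t \<le> 1" "x = (1 - t) *\<^sub>R x0 + t *\<^sub>R b"
      by (auto simp: in_segment)
    define y where "y = (1 - t) *\<^sub>R y0 + t *\<^sub>R yb"
    have "(1 - t) *\<^sub>R (x0, y0) + t *\<^sub>R (b, yb) \<in> sv_graph F"
      by (rule convexD_alt[OF conv]) (use y0 yb t in auto)
    then have "y \<in> F x" by (simp add: y_def t(3))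
    have "x - x0 = t *\<^sub>R (b - x0)" "y - y0 = t *\<^sub>R (yb - y0)"
      by (simp_all add: t(3) y_def algebra_simps)
    then have d: "dist x x0 = t * norm (b - x0)" "dist y y0 = t * norm (yb - y0)"
      using t(1) by (simp_all add: dist_norm)
    from x(2) have "t * norm (b - x0) * (norm (yb - y0) + 1) < \<epsilon> * norm (b - x0)"
      using pos by (simp add: d \<delta>_def pos_less_divide_eq)
    then have "norm (b - x0) * (t * (norm (yb - y0) + 1)) < norm (b - x0) * \<epsilon>"
      by (simp add: mult_ac)
    then have "t * (norm (yb - y0) + 1) < \<epsilon>"
      by (simp add: mult_less_cancel_left)
    then have "dist y y0 < \<epsilon>" using t(1) by (simp add: d algebra_simps)
    with \<open>y \<in> F x\<close> show ?thesis by blast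
  qed
  ultimately show ?thesis by blast
qed

lemma norm_vec_dim1:
  fixes v :: "real ^ 'n"
  assumes "CARD('n) = 1"
  shows "norm v = \<bar>v $ i\<bar>"
proof -
  obtain k where "(UNIV :: 'n set) = {k}"
    using assms by (auto simp: card_1_singleton_iff)
  then have UNIV_eq: "(UNIV :: 'n set) = {i}" by (metis UNIV_I singletonD)
  show ?thesis unfolding norm_vec_def L2_set_def UNIV_eq by simp
qed

lemma vec_dim1_eq_iff:
  fixes v w :: "real ^ 'n"
  assumes "CARD('n) = 1"
  shows "v = w \<longleftrightarrow> v $ i = w $ i"
  using norm_vec_dim1[OF assms, of "v - w" i] by auto

text \<open>The last hypothesis says that \<open>x\<close> and \<open>b\<close> do not lie strictly on opposite sides of \<open>x0\<close>; on a
  line, the comparison of distances then decides betweenness.\<close>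

lemma vec_dim1_on_segment:
  fixes x0 b x :: "real ^ 'n"
  assumes "CARD('n) = 1" "norm (x - x0) \<le> norm (b - x0)" "0 \<le> (x $ i - x0 $ i) * (b $ i - x0 $ i)"
  shows "x \<in> closed_segment x0 b"
proof -
  have le: "\<bar>x $ i - x0 $ i\<bar> \<le> \<bar>b $ i - x0 $ i\<bar>"
    using assms(2) by (simp add: norm_vec_dim1[OF assms(1), of _ i])
  show ?thesis
  proof (cases "b $ i = x0 $ i")
    case True
    with le have "x $ i = x0 $ i" by simp
    then have "x = x0" by (simp add: vec_dim1_eq_iff[OF assms(1), of _ _ i])
    then show ?thesis by simp
  next
    case False
    define t where "t = (x $ i - x0 $ i) / (b $ i - x0 $ i)"
    have "0 \<le> t"
      using assms(3) by (auto simp: t_def zero_le_mult_iff zero_le_divide_iff)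
    moreover have "\<bar>t\<bar> \<le> 1" using le False by (simp add: t_def abs_divide)
    moreover have "t * (b $ i - x0 $ i) = x $ i - x0 $ i" using False by (simp add: t_def)
    then have "x = (1 - t) *\<^sub>R x0 + t *\<^sub>R b"
      by (simp add: vec_dim1_eq_iff[OF assms(1), of _ _ i] algebra_simps)
    ultimately show ?thesis by (auto simp: in_segment)
  qed
qed

lemma lower_semicontinuous_dim1:
  fixes F :: "real ^ 'n \<Rightarrow> 'b::real_normed_vector set"
  assumes dim: "CARD('n) = 1" and conv: "convex (sv_graph F)"
  shows "lower_semicontinuous_on (sv_dom F) F"
  unfolding lower_semicontinuous_on_def
proof (intro ballI allI impI)
  fix x0 y0 and \<epsilon> :: real
  assume y0: "y0 \<in> F x0" and "\<epsilon> > 0"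
  obtain i :: 'n where True by blast
  \<comment> \<open>The sign \<open>s\<close> selects one side of \<open>x0\<close>.\<close>
  have side: "\<exists>\<delta>>0. \<forall>x\<in>sv_dom F. dist x x0 < \<delta> \<longrightarrow> s * (x $ i - x0 $ i) > 0 \<longrightarrow>
      (\<exists>y\<in>F x. dist y y0 < \<epsilon>)" if s: "s = 1 \<or> s = -1" for s :: real
  proof (cases "\<exists>b\<in>sv_dom F. s * (b $ i - x0 $ i) > 0")
    case False
    then show ?thesis by (intro exI[of _ 1]) auto
  next
    case True
    then obtain b yb where b: "s * (b $ i - x0 $ i) > 0" "yb \<in> F b"
      by (auto simp: sv_dom_def)
    then have "b \<noteq> x0" by auto
    from convex_graph_near_on_segment[OF conv y0 b(2) this \<open>\<epsilon> > 0\<close>]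
    obtain \<delta> where \<delta>: "\<delta> > 0"
        "\<And>x. x \<in> closed_segment x0 b \<Longrightarrow> dist x x0 < \<delta> \<Longrightarrow> \<exists>y\<in>F x. dist y y0 < \<epsilon>"
      by blast
    show ?thesis
    proof (intro exI[of _ "min \<delta> (dist b x0)"] conjI ballI impI)
      show "min \<delta> (dist b x0) > 0" using \<delta>(1) \<open>b \<noteq> x0\<close> by simp
      fix x assume x: "dist x x0 < min \<delta> (dist b x0)" "s * (x $ i - x0 $ i) > 0"
      have "x \<in> closed_segment x0 b"
      proof (rule vec_dim1_on_segment[OF dim])
        show "norm (x - x0) \<le> norm (b - x0)" using x(1) by (simp add: dist_norm)
        show "0 \<le> (x $ i - x0 $ i) * (b $ i - x0 $ i)"
          using s x(2) b(1) by (auto simp: zero_le_mult_iff)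
      qed
      then show "\<exists>y\<in>F x. dist y y0 < \<epsilon>" using \<delta>(2) x(1) by simp
    qed
  qed
  from side[of 1] obtain \<delta>1 where \<delta>1: "\<delta>1 > 0"
      "\<And>x. x \<in> sv_dom F \<Longrightarrow> dist x x0 < \<delta>1 \<Longrightarrow> x $ i - x0 $ i > 0 \<Longrightarrow> \<exists>y\<in>F x. dist y y0 < \<epsilon>"
    by auto
  from side[of "-1"] obtain \<delta>2 where \<delta>2: "\<delta>2 > 0"
      "\<And>x. x \<in> sv_dom F \<Longrightarrow> dist x x0 < \<delta>2 \<Longrightarrow> x $ i - x0 $ i < 0 \<Longrightarrow> \<exists>y\<in>F x. dist y y0 < \<epsilon>"
    by auto
  show "\<exists>\<delta>>0. \<forall>x\<in>sv_dom F. dist x x0 < \<delta> \<longrightarrow> (\<exists>y\<in>F x. dist y y0 < \<epsilon>)"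
  proof (intro exI[of _ "min \<delta>1 \<delta>2"] conjI ballI impI)
    show "min \<delta>1 \<delta>2 > 0" using \<delta>1 \<delta>2 by simp
    fix x assume x: "x \<in> sv_dom F" "dist x x0 < min \<delta>1 \<delta>2"
    consider "x $ i - x0 $ i > 0" | "x $ i - x0 $ i < 0" | "x $ i = x0 $ i" by linarith
    then show "\<exists>y\<in>F x. dist y y0 < \<epsilon>"
    proof cases
      case 3
      then have "x = x0" by (simp add: vec_dim1_eq_iff[OF dim, of _ _ i])
      then show ?thesis using y0 \<open>\<epsilon> > 0\<close> by (intro bexI[of _ y0]) auto
    qed (use \<delta>1(2) \<delta>2(2) x in auto)
  qed
qed

section \<open>Graphs that are P-sets\<close>

text \<open>The minimum in \<open>lower_fun\<close> is attained because the chord of \<open>A\<close> through \<open>z\<close> in direction \<open>q\<close>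
  is compact; \<open>q \<bullet> z\<close> is the parameter of \<open>z\<close> itself on that chord.\<close>

lemma lower_fun_attained:
  fixes A :: "'a::euclidean_space set"
  assumes "compact A" "norm q = 1" "z \<in> A"
  shows "proj_along q z + lower_fun A q (proj_along q z) *\<^sub>R q \<in> A"
    and "lower_fun A q (proj_along q z) \<le> q \<bullet> z"
proof -
  let ?p = "proj_along q z"
  let ?M = "{\<mu>. ?p + \<mu> *\<^sub>R q \<in> A}"
  have qq: "q \<bullet> q = 1" using assms(2) by (simp add: norm_eq_1)
  have eq: "?M = (\<lambda>a. q \<bullet> a) ` (A \<inter> {a. proj_along q a = ?p})"
  proof (intro equalityI subsetI)
    fix \<mu> assume "\<mu> \<in> ?M"
    then show "\<mu> \<in> (\<lambda>a. q \<bullet> a) ` (A \<inter> {a. proj_along q a = ?p})"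
      by (intro image_eqI[of _ _ "?p + \<mu> *\<^sub>R q"])
         (auto simp: proj_along_def inner_add_right inner_diff_right qq)
  next
    fix \<mu> assume "\<mu> \<in> (\<lambda>a. q \<bullet> a) ` (A \<inter> {a. proj_along q a = ?p})"
    then obtain a where a: "a \<in> A" "proj_along q a = ?p" "\<mu> = q \<bullet> a" by auto
    have "?p + \<mu> *\<^sub>R q = a" unfolding a(2)[symmetric] a(3) by (simp add: proj_along_def)
    with a(1) show "\<mu> \<in> ?M" by simp
  qed
  have "closed {a. proj_along q a = ?p}"
    unfolding proj_along_def by (intro closed_Collect_eq continuous_intros)
  then have "compact ?M"
    unfolding eq using assms(1)
    by (intro compact_continuous_image continuous_intros compact_Int_closed)
  moreover have z: "q \<bullet> z \<in> ?M" using assms(3) by (simp add: proj_along_def)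
  ultimately obtain m where m: "m \<in> ?M" "\<forall>\<mu>\<in>?M. m \<le> \<mu>"
    using compact_attains_inf[of ?M] by blast
  have "lower_fun A q ?p = m"
    unfolding lower_fun_def by (rule Least_equality) (use m in auto)
  with m z show "?p + lower_fun A q ?p *\<^sub>R q \<in> A" "lower_fun A q ?p \<le> q \<bullet> z" by auto
qed

text \<open>The lower end of the chord and \<open>z\<close> itself both lie in \<open>A\<close>, hence so does the segment that
  joins them.\<close>

lemma chord_point_in_convex:
  fixes A :: "'a::euclidean_space set"
  assumes "convex A" "compact A" "norm q = 1" "z \<in> A"
    and "lower_fun A q (proj_along q z) \<le> \<mu>" "\<mu> \<le> q \<bullet> z"
  shows "proj_along q z + \<mu> *\<^sub>R q \<in> A"
proof -
  let ?p = "proj_along q z"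
  let ?l = "lower_fun A q ?p"
  have "(\<lambda>t. ?p + t *\<^sub>R q) -` A = (\<lambda>t. t *\<^sub>R q) -` ((\<lambda>a. a - ?p) ` A)"
    by (force simp: image_iff algebra_simps)
  moreover have "linear (\<lambda>t. t *\<^sub>R q)"
    by (simp add: linear_iff scaleR_add_left)
  ultimately have "convex ((\<lambda>t. ?p + t *\<^sub>R q) -` A)"
    using assms(1) by (simp add: convex_linear_vimage)
  then have "is_interval ((\<lambda>t. ?p + t *\<^sub>R q) -` A)"
    by (simp add: is_interval_convex_1)
  moreover have "?l \<in> (\<lambda>t. ?p + t *\<^sub>R q) -` A"
    using lower_fun_attained(1)[OF assms(2-4)] by simp
  moreover have "q \<bullet> z \<in> (\<lambda>t. ?p + t *\<^sub>R q) -` A"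
    using assms(4) by (simp add: proj_along_def)
  ultimately have "\<mu> \<in> (\<lambda>t. ?p + t *\<^sub>R q) -` A"
    using assms(5,6) unfolding is_interval_1 by blast
  then show ?thesis by simp
qed

text \<open>The heights \<open>\<mu>\<^sub>k = max (f (P z\<^sub>k)) (q \<bullet> z\<^sub>0)\<close> with \<open>f = lower_fun A q\<close> and
  \<open>P = proj_along q\<close> eventually lie on the chord below \<open>z\<^sub>k\<close>, because \<open>q \<bullet> z\<^sub>k\<close> tends to
  \<open>q \<bullet> z\<^sub>0 + c\<close>. They tend to \<open>q \<bullet> z\<^sub>0\<close>, because continuity of \<open>f\<close> gives
  \<open>f (P z\<^sub>k) \<longlongrightarrow> f (P z\<^sub>0) \<le> q \<bullet> z\<^sub>0\<close>.\<close>

lemma P_set_shift_limit: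
  fixes A :: "'a::euclidean_space set"
  assumes P: "P_set A" and q: "norm q = 1" and "c > 0" and z0: "z0 \<in> A"
    and Z: "\<And>k::nat. Z k \<in> A" "Z \<longlonglongrightarrow> z0 + c *\<^sub>R q"
  obtains \<nu> where "\<forall>\<^sub>F k in sequentially. Z k + \<nu> k *\<^sub>R q \<in> A" "(\<lambda>k. Z k + \<nu> k *\<^sub>R q) \<longlonglongrightarrow> z0"
proof -
  let ?P = "proj_along q" and ?f = "lower_fun A q"
  have A: "convex A" "compact A" and cont: "continuous_on (?P ` A) ?f"
    using P q by (auto simp: P_set_def)
  have qq: "q \<bullet> q = 1" using q by (simp add: norm_eq_1)
  have P0: "?P (z0 + c *\<^sub>R q) = ?P z0"
    by (simp add: proj_along_def inner_add_right qq algebra_simps)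
  have limP: "(\<lambda>k. ?P (Z k)) \<longlonglongrightarrow> ?P z0"
  proof -
    have "(\<lambda>k. ?P (Z k)) \<longlonglongrightarrow> ?P (z0 + c *\<^sub>R q)"
      unfolding proj_along_def by (intro tendsto_intros Z(2))
    then show ?thesis by (simp only: P0)
  qed
  have limf: "(\<lambda>k. ?f (?P (Z k))) \<longlonglongrightarrow> ?f (?P z0)"
    by (rule continuous_on_tendsto_compose[OF cont limP]) (use z0 Z(1) in auto)
  have limq: "(\<lambda>k. q \<bullet> Z k) \<longlonglongrightarrow> q \<bullet> z0 + c"
    using tendsto_inner[OF tendsto_const Z(2), of q] by (simp add: inner_add_right qq)
  have f0: "?f (?P z0) \<le> q \<bullet> z0" by (rule lower_fun_attained(2)[OF A(2) q z0])
  define \<mu> where "\<mu> k = max (?f (?P (Z k))) (q \<bullet> z0)" for k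
  have "\<mu> \<longlonglongrightarrow> max (?f (?P z0)) (q \<bullet> z0)"
    unfolding \<mu>_def by (intro tendsto_max limf tendsto_const)
  then have lim\<mu>: "\<mu> \<longlonglongrightarrow> q \<bullet> z0" using f0 by simp
  have shift: "Z k + (\<mu> k - q \<bullet> Z k) *\<^sub>R q = ?P (Z k) + \<mu> k *\<^sub>R q" for k
    by (simp add: proj_along_def algebra_simps)
  have "\<forall>\<^sub>F k in sequentially. q \<bullet> z0 < q \<bullet> Z k"
    by (rule order_tendstoD(1)[OF limq]) (use \<open>c > 0\<close> in simp)
  then have "\<forall>\<^sub>F k in sequentially. Z k + (\<mu> k - q \<bullet> Z k) *\<^sub>R q \<in> A"
  proof eventually_elim
    case (elim k)
    have "?P (Z k) + \<mu> k *\<^sub>R q \<in> A"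
      by (rule chord_point_in_convex[OF A q Z(1)])
         (use elim lower_fun_attained(2)[OF A(2) q Z(1)] in \<open>auto simp: \<mu>_def\<close>)
    then show ?case by (simp only: shift)
  qed
  moreover have "(\<lambda>k. ?P (Z k) + \<mu> k *\<^sub>R q) \<longlonglongrightarrow> ?P z0 + (q \<bullet> z0) *\<^sub>R q"
    by (intro tendsto_intros limP lim\<mu>)
  then have "(\<lambda>k. Z k + (\<mu> k - q \<bullet> Z k) *\<^sub>R q) \<longlonglongrightarrow> z0"
    unfolding shift by (simp add: proj_along_def)
  ultimately show ?thesis by (rule that)
qed

lemma lower_semicontinuous_P_set:
  fixes F :: "'a::euclidean_space \<Rightarrow> 'b::euclidean_space set"
  assumes P: "P_set (sv_graph F)"
  shows "lower_semicontinuous_on (sv_dom F) F"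
  unfolding lower_semicontinuous_on_def
proof (intro ballI allI impI, rule ccontr)
  fix x0 y0 and \<epsilon> :: real
  assume y0: "y0 \<in> F x0" and "\<epsilon> > 0"
    and no: "\<not> (\<exists>\<delta>>0. \<forall>x\<in>sv_dom F. dist x x0 < \<delta> \<longrightarrow> (\<exists>y\<in>F x. dist y y0 < \<epsilon>))"
  obtain X where X: "\<And>k. X k \<in> sv_dom F" "X \<longlonglongrightarrow> x0"
      "\<And>k. \<not> (\<exists>y\<in>F (X k). dist y y0 < \<epsilon>)"
    by (rule sequence_if_no_delta[OF no]) (rule that)
  from X(1) have "\<forall>k. \<exists>y. y \<in> F (X k)" by (simp add: sv_dom_def ex_in_conv)
  then obtain Y where Y: "\<And>k. Y k \<in> F (X k)" by metis
  have cpt: "compact (sv_graph F)" using P by (simp add: P_set_def)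
  from compact_graph_convergent_subseq[OF cpt Y X(2)]
  obtain y1 r where y1: "y1 \<in> F x0" "strict_mono r" "(\<lambda>k. Y (r k)) \<longlonglongrightarrow> y1" .
  have "y1 \<noteq> y0"
  proof
    assume "y1 = y0"
    with tendstoD[OF y1(3) \<open>\<epsilon> > 0\<close>] obtain k where "dist (Y (r k)) y0 < \<epsilon>"
      by (auto simp: eventually_sequentially)
    with X(3)[of "r k"] Y[of "r k"] show False by blast
  qed
  define c where "c = norm (y1 - y0)"
  define q :: "'a \<times> 'b" where "q = (0, (y1 - y0) /\<^sub>R c)"
  have "c > 0" using \<open>y1 \<noteq> y0\<close> by (simp add: c_def)
  have q: "norm q = 1" using \<open>c > 0\<close> by (simp add: q_def norm_Pair c_def)
  have "(\<lambda>k. X (r k)) \<longlonglongrightarrow> x0"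
    using LIMSEQ_subseq_LIMSEQ[OF X(2) y1(2)] by (simp add: o_def)
  from tendsto_Pair[OF this y1(3)]
  have lim: "(\<lambda>k. (X (r k), Y (r k))) \<longlonglongrightarrow> (x0, y0) + c *\<^sub>R q"
    using \<open>c > 0\<close> by (simp add: q_def)
  have G: "(x0, y0) \<in> sv_graph F" "\<And>k. (X (r k), Y (r k)) \<in> sv_graph F"
    using y0 Y by simp_all
  obtain \<nu> where \<nu>:
      "\<forall>\<^sub>F k in sequentially. (X (r k), Y (r k)) + \<nu> k *\<^sub>R q \<in> sv_graph F"
      "(\<lambda>k. (X (r k), Y (r k)) + \<nu> k *\<^sub>R q) \<longlonglongrightarrow> (x0, y0)"
    by (rule P_set_shift_limit[OF P q \<open>c > 0\<close> G lim]) (rule that)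
  define Y' where "Y' k = snd ((X (r k), Y (r k)) + \<nu> k *\<^sub>R q)" for k
  have eq: "(X (r k), Y (r k)) + \<nu> k *\<^sub>R q = (X (r k), Y' k)" for k
    by (simp add: Y'_def q_def)
  have "Y' \<longlonglongrightarrow> y0" using tendsto_snd[OF \<nu>(2)] by (simp add: Y'_def[abs_def])
  from eventually_conj[OF \<nu>(1)[unfolded eq] tendstoD[OF this \<open>\<epsilon> > 0\<close>]]
  obtain k where "Y' k \<in> F (X (r k))" "dist (Y' k) y0 < \<epsilon>"
    by (auto simp: eventually_sequentially)
  with X(3)[of "r k"] show False by blast
qed

section \<open>Continuity of set-valued mappings with convex graph\<close>

theorem corollary2p5:
  fixes F :: "real ^ 'n \<Rightarrow> (real ^ 'm) set"
  assumes "convex (sv_graph F)" and "closed (sv_graph F)"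
  shows "(CARD('n) = 1 \<and> convex (sv_graph F) \<and> compact (sv_graph F)
            \<longrightarrow> hausdorff_continuous_on (sv_dom F) F) \<and>
         (P_set (sv_graph F) \<longrightarrow> hausdorff_continuous_on (sv_dom F) F)"
proof (intro conjI impI)
  assume "CARD('n) = 1 \<and> convex (sv_graph F) \<and> compact (sv_graph F)"
  then have "CARD('n) = 1" "convex (sv_graph F)" "compact (sv_graph F)" by blast+
  then show "hausdorff_continuous_on (sv_dom F) F"
    using hausdorff_continuous_on_if_compact_graph[OF _ lower_semicontinuous_dim1] by blast
next
  assume P: "P_set (sv_graph F)"
  show "hausdorff_continuous_on (sv_dom F) F"
  proof (rule hausdorff_continuous_on_if_compact_graph)
    show "compact (sv_graph F)" using P by (simp add: P_set_def)
    show "lower_semicontinuous_on (sv_dom F) F" by (rule lower_semicontinuous_P_set[OF P])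
  qed
qed

end
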